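(* Let $T>0$, $d,m\in\mathbb{N}$, and let $(\Omega,\mathcal{F},(\mathcal{F}_t)_{t\in[0,T]},\mathbb{P})$ be a filtered probability space carrying a standard $(\mathcal{F}_t)_{t\in[0,T]}$-Wiener process $W\colon[0,T]\times\Omega\to\mathbb{R}^m$. Let $X_0\in\mathbb{R}^d$ be deterministic, and let $f\colon\mathbb{R}^d\to\mathbb{R}^d$ and $g\colon\mathbb{R}^d\to\mathbb{R}^{d\times m}$ be continuous functions for which there exists $L\ge0$ such that $$\langle f(x),x\rangle+\frac12|g(x)|^2\le L\big(1+|x|^2\big)\quad\text{for all }x\in\mathbb{R}^d.$$ Let $h_0\in(0,(2L)^{-1})$. Then for every $p\in(0,1)$, every step size $h\in(0,1)$ with $h\in(0,h_0)$, with $N_h\in\mathbb{N}$ determined by $N_hh\le T<(N_h+1)h$, and every $\mathbb{R}^d$-valued process $(Y^n)_{0\le n\le N_h}$ that is adapted to $(\mathcal{F}_{nh})_{0\le n\le N_h}$ and satisfies the backward Euler-Maruyama recursion $$Y^{j+1}=Y^j+hf(Y^{j+1})+g(Y^j)\big(W((j+1)h)-W(jh)\big),\quad j=0,\ldots,N_h-1,\qquad Y^0=X_0,$$ we have $$\mathbb{E}\Big[\sup_{0\le j\le N_h}\big(|Y^j|^2+h|g(Y^j)|^2\big)^p\Big]\le\Big(1+\frac{1}{1-p}\Big)\exp\big(p(1-2h_0L)^{-1}2LT\big)\Big(|X_0|^2+(1-2h_0L)^{-1}\big(h_0|g(X_0)|^2+2LT\big)\Big)^p.$$ In particular, this bound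 is independent of the step size $h$.
   Context: $\mathbb{N}=\{1,2,\ldots\}$. $|\cdot|$ denotes the Euclidean norm on $\mathbb{R}^d$ and $\mathbb{R}^m$, and the Frobenius norm on matrices in $\mathbb{R}^{d\times m}$; $\langle\cdot,\cdot\rangle$ is the Euclidean inner product on $\mathbb{R}^d$. A standard $(\mathcal{F}_t)$-Wiener process is one that is adapted to $(\mathcal{F}_t)$ and whose increments $W(t)-W(s)$, $s\le t$, are independent of $\mathcal{F}_s$. If $L=0$, then $(2L)^{-1}$ is read as $+\infty$. *)

theory Defs
  imports "HOL-Probability.Probability"
begin

definition filtration_upto :: "'a measure \<Rightarrow> real \<Rightarrow> (real \<Rightarrow> 'a measure) \<Rightarrow> bool" where
  "filtration_upto M T F \<longleftrightarrow>
     (\<forall>t\<in>{0..T}. subalgebra M (F t)) \<and>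
     (\<forall>s t. 0 \<le> s \<longrightarrow> s \<le> t \<longrightarrow> t \<le> T \<longrightarrow> subalgebra (F t) (F s))"

text \<open>
  Standard Wiener process on \<open>[0, T]\<close> with values in \<open>\<real>\<^sup>m\<close>, relative to the filtration \<open>F\<close>:
  the product of one-dimensional centred normal densities with variance \<open>t - s\<close> is the density
  of \<open>N(0, (t - s) I)\<close>. Values of \<open>W\<close> and \<open>F\<close> outside \<open>[0, T]\<close> are irrelevant.
\<close>

definition standard_wiener_process ::
    "'a measure \<Rightarrow> real \<Rightarrow> (real \<Rightarrow> 'a measure) \<Rightarrow> (real \<Rightarrow> 'a \<Rightarrow> real ^ 'm) \<Rightarrow> bool" where
  "standard_wiener_process M T F W \<longleftrightarrow>
     (\<forall>t\<in>{0..T}. W t \<in> borel_measurable (F t)) \<and>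
     (AE \<omega> in M. W 0 \<omega> = 0) \<and>
     (AE \<omega> in M. continuous_on {0..T} (\<lambda>t. W t \<omega>)) \<and>
     (\<forall>s t. 0 \<le> s \<longrightarrow> s < t \<longrightarrow> t \<le> T \<longrightarrow>
        distributed M lborel (\<lambda>\<omega>. W t \<omega> - W s \<omega>)
          (\<lambda>x. ennreal (\<Prod>i\<in>UNIV. normal_density 0 (sqrt (t - s)) (x $ i)))) \<and>
     (\<forall>s t. 0 \<le> s \<longrightarrow> s \<le> t \<longrightarrow> t \<le> T \<longrightarrow>
        prob_space.indep_set M (sets (F s))
          (sets (vimage_algebra (space M) (\<lambda>\<omega>. W t \<omega> - W s \<omega>) borel)))"

text \<open>
  The recursion is an identity between random variables and is therefore required to hold
  almost surely.
\<close>

definition backward_euler_maruyama ::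
    "'a measure \<Rightarrow> (real \<Rightarrow> 'a \<Rightarrow> real ^ 'm) \<Rightarrow> (real ^ 'd \<Rightarrow> real ^ 'd) \<Rightarrow>
     (real ^ 'd \<Rightarrow> real ^ 'm ^ 'd) \<Rightarrow> real ^ 'd \<Rightarrow> real \<Rightarrow> nat \<Rightarrow> (nat \<Rightarrow> 'a \<Rightarrow> real ^ 'd) \<Rightarrow> bool" where
  "backward_euler_maruyama M W f g X0 h N Y \<longleftrightarrow>
     (AE \<omega> in M. Y 0 \<omega> = X0) \<and>
     (\<forall>j<N. AE \<omega> in M.
        Y (j + 1) \<omega> = Y j \<omega> + h *\<^sub>R f (Y (j + 1) \<omega>)
          + g (Y j \<omega>) *v (W (real (j + 1) * h) \<omega> - W (real j * h) \<omega>))"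

text \<open>The library norm on matrices is the Frobenius norm.\<close>

lemma norm_matrix_Frobenius:
  fixes A :: "real ^ 'm ^ 'd"
  shows "norm A = sqrt (\<Sum>i\<in>UNIV. \<Sum>j\<in>UNIV. (A $ i $ j)\<^sup>2)"
  by (simp add: norm_vec_def L2_set_def sum_nonneg)

end

theory Submission
  imports Defs
begin

text \<open>
  Let \<open>y\<close>, \<open>y'\<close> be consecutive values of the scheme. Testing the recursion with \<open>y'\<close> gives
  \<open>(1 - 2hL) |y'|\<^sup>2 + h |g(y')|\<^sup>2 \<le> |y + g(y) \<Delta>W|\<^sup>2 + 2hL\<close>, and by independence the
  right-hand side has conditional expectation \<open>|y|\<^sup>2 + h |g(y)|\<^sup>2 + 2hL\<close>. Hence the left-hand side,
  discounted by the factor \<open>1 - 2hL\<close> per step and increased by the deterministic terms still to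
  come, is a nonnegative supermartingale. The maximal inequality bounds the tail of its supremum by
  \<open>K / l\<close>, and integrating the tail gives \<open>K\<^sup>p / (1 - p)\<close> for the moment of order \<open>p < 1\<close>. All
  integrands are nonnegative, so no integrability of the scheme has to be established first.
\<close>

section \<open>Moments of order below one from a tail bound\<close>

text \<open>Layer-cake argument: \<open>X powr p\<close> is at most \<open>K powr p\<close> plus the
  integral of \<open>p * l powr (p - 1)\<close> over the levels \<open>l\<close> between
  \<open>K\<close> and \<open>X\<close>. In expectation the tail bound turns the second term into
  the integral of \<open>K * p * l powr (p - 2)\<close> over \<open>l \<ge> K\<close>, which is
  \<open>p / (1 - p) * K powr p\<close>. Strict positivity of \<open>K\<close> keeps the levels away
  from the singularity at 0.\<close>

lemma (in prob_space) nn_integral_powr_le_of_tail_pos: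
  fixes X :: "'a \<Rightarrow> real"
  assumes X[measurable]: "X \<in> borel_measurable M" and nonneg: "\<And>\<omega>. 0 \<le> X \<omega>"
    and tail: "\<And>l. 0 < l \<Longrightarrow> ennreal l * emeasure M {\<omega>\<in>space M. l \<le> X \<omega>} \<le> ennreal K"
    and K: "0 < K" and p: "0 < p" "p < 1"
  shows "(\<integral>\<^sup>+\<omega>. ennreal (X \<omega> powr p) \<partial>M) \<le> ennreal (K powr p / (1 - p))"
proof -
  interpret pair_sigma_finite lborel M ..
  \<comment> \<open>The levels are split at \<open>K\<close> because below it \<open>K / l\<close>
    exceeds the trivial bound 1 for a probability. The two indicators stay separate factors: after
    the integrals are exchanged, the first is constant in \<omega> and the second is the event
    \<open>l \<le> X \<omega>\<close>.\<close>
  have layer: "ennreal (x powr p) \<le> ennreal (K powr p)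
      + (\<integral>\<^sup>+l. ennreal (p * l powr (p - 1)) * indicator {K..} l * indicator {..x} l \<partial>lborel)"
    if "0 \<le> x" for x
  proof (cases "x \<le> K")
    case True
    then have "x powr p \<le> K powr p"
      using that p by (intro powr_mono2) auto
    then show ?thesis
      by (intro add_increasing2 ennreal_leI) auto
  next
    case False
    have "(\<integral>\<^sup>+l. ennreal (p * l powr (p - 1)) * indicator {K..} l * indicator {..x} l \<partial>lborel)
        = (\<integral>\<^sup>+l. ennreal (p * l powr (p - 1)) * indicator {K..x} l \<partial>lborel)"
      by (intro nn_integral_cong) (auto split: split_indicator)
    also have "\<dots> = ennreal (x powr p - K powr p)"
      using False K p
      by (intro nn_integral_FTC_Icc) (auto intro!: derivative_eq_intros)
    finally have eq: "(\<integral>\<^sup>+l. ennreal (p * l powr (p - 1)) * indicator {K..} l * indicator {..x} l \<partial>lborel)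
        = ennreal (x powr p - K powr p)" .
    have "K powr p \<le> x powr p"
      using False K p by (intro powr_mono2) auto
    then show ?thesis
      unfolding eq by (subst ennreal_plus[symmetric]) auto
  qed
  have "(\<integral>\<^sup>+\<omega>. ennreal (X \<omega> powr p) \<partial>M)
      \<le> (\<integral>\<^sup>+\<omega>. (ennreal (K powr p)
      + (\<integral>\<^sup>+l. ennreal (p * l powr (p - 1)) * indicator {K..} l * indicator {..X \<omega>} l \<partial>lborel)) \<partial>M)"
    by (intro nn_integral_mono layer nonneg)
  also have "\<dots> = ennreal (K powr p)
      + (\<integral>\<^sup>+\<omega>. (\<integral>\<^sup>+l. ennreal (p * l powr (p - 1)) * indicator {K..} l * indicator {..X \<omega>} l \<partial>lborel) \<partial>M)"
    by (subst nn_integral_add) (auto simp: emeasure_space_1 atMost_def indicator_def of_bool_def)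
  also have "(\<integral>\<^sup>+\<omega>. (\<integral>\<^sup>+l. ennreal (p * l powr (p - 1)) * indicator {K..} l * indicator {..X \<omega>} l \<partial>lborel) \<partial>M)
     = (\<integral>\<^sup>+l. (\<integral>\<^sup>+\<omega>. ennreal (p * l powr (p - 1)) * indicator {K..} l * indicator {..X \<omega>} l \<partial>M) \<partial>lborel)"
    by (intro Fubini') (simp add: atMost_def indicator_def of_bool_def)
  also have "\<dots> \<le> (\<integral>\<^sup>+l. ennreal (K * p * l powr (p - 2)) * indicator {K..} l \<partial>lborel)"
  proof (intro nn_integral_mono)
    fix l :: real
    have "(\<integral>\<^sup>+\<omega>. ennreal (p * l powr (p - 1)) * indicator {K..} l * indicator {..X \<omega>} l \<partial>M)
      = (\<integral>\<^sup>+\<omega>. (ennreal (p * l powr (p - 1)) * indicator {K..} l) * indicator {\<omega>\<in>space M. l \<le> X \<omega>} \<omega> \<partial>M)"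
      by (intro nn_integral_cong) (auto split: split_indicator)
    also have "\<dots> = ennreal (p * l powr (p - 1)) * indicator {K..} l * emeasure M {\<omega>\<in>space M. l \<le> X \<omega>}"
      by (subst nn_integral_cmult_indicator) auto
    also have "\<dots> \<le> ennreal (K * p * l powr (p - 2)) * indicator {K..} l"
    proof (cases "K \<le> l")
      case True
      then have l: "0 < l" using K by simp
      \<comment> \<open>One factor \<open>l\<close> is split off so that the tail hypothesis applies
        to \<open>l\<close> times the probability.\<close>
      have "ennreal (p * l powr (p - 1)) = ennreal (p * l powr (p - 2)) * ennreal l"
        using l p by (subst ennreal_mult[symmetric]) (auto simp: powr_diff power2_eq_square)
      then have "ennreal (p * l powr (p - 1)) * emeasure M {\<omega>\<in>space M. l \<le> X \<omega>}
        = ennreal (p * l powr (p - 2)) * (ennreal l * emeasure M {\<omega>\<in>space M. l \<le> X \<omega>})"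
        by (simp add: mult.assoc)
      also have "\<dots> \<le> ennreal (p * l powr (p - 2)) * ennreal K"
        by (intro mult_left_mono tail l) auto
      also have "\<dots> = ennreal (K * p * l powr (p - 2))"
        using p K by (subst ennreal_mult[symmetric]) (auto simp: mult_ac)
      finally show ?thesis using True by simp
    qed simp
    finally show "(\<integral>\<^sup>+\<omega>. ennreal (p * l powr (p - 1)) * indicator {K..} l * indicator {..X \<omega>} l \<partial>M)
      \<le> ennreal (K * p * l powr (p - 2)) * indicator {K..} l" .
  qed
  also have "\<dots> = ennreal (0 - (- (K * p / (1 - p) * K powr (p - 1))))"
  proof (rule nn_integral_FTC_atLeast[where F = "\<lambda>l. - (K * p / (1 - p) * l powr (p - 1))" and T = 0])
    \<comment> \<open>The exponent \<open>p - 1\<close> is negative, so the antiderivative vanishes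
      at infinity and only its value at \<open>K\<close> remains.\<close>
    show "((\<lambda>l. - (K * p / (1 - p) * l powr (p - 1))) \<longlongrightarrow> 0) at_top"
    proof -
      have "((\<lambda>l. l powr (p - 1)) \<longlongrightarrow> 0) at_top"
        using p by (intro tendsto_neg_powr filterlim_ident) auto
      then show ?thesis
        using tendsto_minus[OF tendsto_mult_right_zero[of _ at_top "K * p / (1 - p)"]] by simp
    qed
    show "((\<lambda>l. - (K * p / (1 - p) * l powr (p - 1))) has_real_derivative K * p * l powr (p - 2)) (at l)"
      if "K \<le> l" for l
    proof -
      have "((\<lambda>l. - (K * p / (1 - p) * l powr (p - 1))) has_real_derivative
          - (K * p / (1 - p) * ((p - 1) * l powr (p - 1 - 1)))) (at l)"
        using that K by (intro DERIV_minus DERIV_cmult has_real_derivative_powr) auto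
      moreover have "- (K * p / (1 - p) * ((p - 1) * y)) = K * p * y" for y
        using p by (simp add: divide_simps) (simp add: algebra_simps)
      ultimately show ?thesis by simp
    qed
  qed (use K p in auto)
  finally have "(\<integral>\<^sup>+\<omega>. ennreal (X \<omega> powr p) \<partial>M)
      \<le> ennreal (K powr p) + ennreal (K * p / (1 - p) * K powr (p - 1))"
    by (simp add: add_left_mono)
  also have "\<dots> = ennreal (K powr p / (1 - p))"
    using K p by (subst ennreal_plus[symmetric]) (auto simp: powr_diff field_simps)
  finally show ?thesis .
qed

text \<open>Every \<open>k > K\<close> is strictly positive and bounds the tail as well, so the
  previous estimate holds for \<open>k\<close>; its right-hand side is continuous, and
  \<open>k\<close> decreases to \<open>K\<close>. This admits \<open>K = 0\<close>, which occurs
  when the initial energy and \<open>L\<close> vanish.\<close>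

lemma (in prob_space) nn_integral_powr_le_of_tail:
  fixes X :: "'a \<Rightarrow> real"
  assumes X: "X \<in> borel_measurable M" and nonneg: "\<And>\<omega>. 0 \<le> X \<omega>"
    and tail: "\<And>l. 0 < l \<Longrightarrow> ennreal l * emeasure M {\<omega>\<in>space M. l \<le> X \<omega>} \<le> ennreal K"
    and K: "0 \<le> K" and p: "0 < p" "p < 1"
  shows "(\<integral>\<^sup>+\<omega>. ennreal (X \<omega> powr p) \<partial>M) \<le> ennreal (K powr p / (1 - p))"
proof (rule tendsto_lowerbound)
  show "((\<lambda>k. ennreal (k powr p / (1 - p))) \<longlongrightarrow> ennreal (K powr p / (1 - p))) (at_right K)"
    using p K eventually_at_right_less[of K]
    by (intro tendsto_intros tendsto_powr2) (auto elim!: eventually_mono)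
  show "\<forall>\<^sub>F k in at_right K. (\<integral>\<^sup>+\<omega>. ennreal (X \<omega> powr p) \<partial>M) \<le> ennreal (k powr p / (1 - p))"
  proof (rule eventually_at_right_less[THEN eventually_mono])
    fix k assume "K < k"
    then show "(\<integral>\<^sup>+\<omega>. ennreal (X \<omega> powr p) \<partial>M) \<le> ennreal (k powr p / (1 - p))"
      using K by (intro nn_integral_powr_le_of_tail_pos X nonneg p order.trans[OF tail] ennreal_leI) auto
  qed
qed simp

section \<open>Maximal inequality for supermartingales\<close>

text \<open>Stop each path when it first reaches the level \<open>l\<close>: the stopped paths carry
  at least \<open>l\<close> times their probability, and the integral over the running ones does not
  grow. The supermartingale property is tested on sets of \<open>G n\<close> by nonnegative
  integrals instead of conditional expectations, so it makes sense without integrability.\<close>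

lemma (in prob_space) nn_supermartingale_maximal_inequality:
  fixes S :: "nat \<Rightarrow> 'a \<Rightarrow> real"
  assumes sub: "\<And>n. n \<le> N \<Longrightarrow> subalgebra M (G n)"
    and filt: "\<And>m n. m \<le> n \<Longrightarrow> n \<le> N \<Longrightarrow> subalgebra (G n) (G m)"
    and S: "\<And>n. n \<le> N \<Longrightarrow> S n \<in> borel_measurable (G n)"
    and step: "\<And>n A. n < N \<Longrightarrow> A \<in> sets (G n) \<Longrightarrow>
      (\<integral>\<^sup>+\<omega>. ennreal (S (Suc n) \<omega>) * indicator A \<omega> \<partial>M) \<le> (\<integral>\<^sup>+\<omega>. ennreal (S n \<omega>) * indicator A \<omega> \<partial>M)"
  shows "ennreal l * emeasure M {\<omega>\<in>space M. \<exists>j\<le>N. l \<le> S j \<omega>} \<le> (\<integral>\<^sup>+\<omega>. ennreal (S 0 \<omega>) \<partial>M)"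
proof -
  define E where "E n = {\<omega>\<in>space M. \<forall>j\<le>n. S j \<omega> < l}" for n
  define H where "H n = {\<omega>\<in>space M. \<exists>j\<le>n. l \<le> S j \<omega>}" for n
  have SM: "S n \<in> borel_measurable M" if "n \<le> N" for n
    using measurable_from_subalg[OF sub S] that by blast
  have E: "E n \<in> sets (G n)" if "n \<le> N" for n
  proof -
    have [measurable]: "S j \<in> borel_measurable (G n)" if "j \<le> n" for j
      using measurable_from_subalg[OF filt S] that \<open>n \<le> N\<close> by simp
    have "{\<omega>\<in>space (G n). \<forall>j\<in>{..n}. S j \<omega> < l} \<in> sets (G n)"
      by measurable
    moreover have "{\<omega>\<in>space (G n). \<forall>j\<in>{..n}. S j \<omega> < l} = E n"
      using sub[OF that] unfolding E_def subalgebra_def by auto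
    ultimately show ?thesis
      by (rule back_subst)
  qed
  have EM: "E n \<in> sets M" if "n \<le> N" for n
    using E[OF that] sub[OF that] by (auto simp: subalgebra_def)
  have HE: "H n = space M - E n" for n
    by (auto simp: H_def E_def not_less)
  have HM: "H n \<in> sets M" if "n \<le> N" for n
    using EM[OF that] by (simp add: HE)
  \<comment> \<open>If no path in \<open>B\<close> has reached the level before time
    \<open>n\<close>, those outside \<open>E n\<close> reach it exactly at \<open>n\<close>, so
    \<open>S n\<close> is at least \<open>l\<close> there. This is applied to
    \<open>B = space M\<close> at time 0 and to \<open>B = E n\<close> at time
    \<open>Suc n\<close>.\<close>
  have split: "(\<integral>\<^sup>+\<omega>. ennreal (S n \<omega>) * indicator B \<omega> \<partial>M)
      \<ge> ennreal l * emeasure M (B - E n) + (\<integral>\<^sup>+\<omega>. ennreal (S n \<omega>) * indicator (B \<inter> E n) \<omega> \<partial>M)"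
    if "n \<le> N" and [measurable]: "B \<in> sets M" and B: "\<And>\<omega> j. \<omega> \<in> B \<Longrightarrow> j < n \<Longrightarrow> S j \<omega> < l" for n B
  proof -
    note [measurable] = EM[OF \<open>n \<le> N\<close>] SM[OF \<open>n \<le> N\<close>]
    have "ennreal l * emeasure M (B - E n) + (\<integral>\<^sup>+\<omega>. ennreal (S n \<omega>) * indicator (B \<inter> E n) \<omega> \<partial>M)
      = (\<integral>\<^sup>+\<omega>. ennreal l * indicator (B - E n) \<omega> + ennreal (S n \<omega>) * indicator (B \<inter> E n) \<omega> \<partial>M)"
      by (subst nn_integral_add) (auto simp: nn_integral_cmult_indicator)
    also have "\<dots> \<le> (\<integral>\<^sup>+\<omega>. ennreal (S n \<omega>) * indicator B \<omega> \<partial>M)"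
    proof (intro nn_integral_mono)
      fix \<omega> assume "\<omega> \<in> space M"
      then have "l \<le> S n \<omega>" if "\<omega> \<in> B - E n"
      proof -
        obtain j where "j \<le> n" "l \<le> S j \<omega>"
          using \<open>\<omega> \<in> B - E n\<close> \<open>\<omega> \<in> space M\<close> by (auto simp: E_def not_less)
        moreover have "\<not> j < n"
          using B[of \<omega> j] that \<open>l \<le> S j \<omega>\<close> by auto
        ultimately show ?thesis by simp
      qed
      then show "ennreal l * indicator (B - E n) \<omega> + ennreal (S n \<omega>) * indicator (B \<inter> E n) \<omega>
          \<le> ennreal (S n \<omega>) * indicator B \<omega>"
        by (auto split: split_indicator intro: ennreal_leI)
    qed
    finally show ?thesis .
  qed
  \<comment> \<open>Invariant of the induction: the first summand accounts for the paths already
    stopped, the second for those still running. At \<open>n = N\<close> the second is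
    dropped.\<close>
  have "ennreal l * emeasure M (H n) + (\<integral>\<^sup>+\<omega>. ennreal (S n \<omega>) * indicator (E n) \<omega> \<partial>M)
      \<le> (\<integral>\<^sup>+\<omega>. ennreal (S 0 \<omega>) \<partial>M)" if "n \<le> N" for n
    using that
  proof (induction n)
    case 0
    have "(\<integral>\<^sup>+\<omega>. ennreal (S 0 \<omega>) * indicator (space M) \<omega> \<partial>M) = (\<integral>\<^sup>+\<omega>. ennreal (S 0 \<omega>) \<partial>M)"
      by (intro nn_integral_cong) auto
    moreover have "space M \<inter> E 0 = E 0" by (auto simp: E_def)
    ultimately show ?case
      using split[of 0 "space M"] by (simp add: HE)
  next
    case (Suc n)
    then have n: "n < N" "n \<le> N" by auto
    have Hs: "H (Suc n) = H n \<union> (E n - E (Suc n))" and dis: "H n \<inter> (E n - E (Suc n)) = {}"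
      and Es: "E n \<inter> E (Suc n) = E (Suc n)"
      by (auto simp: HE E_def)
    have "emeasure M (H (Suc n)) = emeasure M (H n) + emeasure M (E n - E (Suc n))"
      unfolding Hs using n Suc.prems by (intro plus_emeasure[symmetric] dis sets.Diff EM HM) auto
    then have "ennreal l * emeasure M (H (Suc n)) + (\<integral>\<^sup>+\<omega>. ennreal (S (Suc n) \<omega>) * indicator (E (Suc n)) \<omega> \<partial>M)
       = ennreal l * emeasure M (H n) + (ennreal l * emeasure M (E n - E (Suc n))
         + (\<integral>\<^sup>+\<omega>. ennreal (S (Suc n) \<omega>) * indicator (E n \<inter> E (Suc n)) \<omega> \<partial>M))"
      unfolding Es by (simp add: distrib_left add.assoc)
    also have "\<dots> \<le> ennreal l * emeasure M (H n) + (\<integral>\<^sup>+\<omega>. ennreal (S (Suc n) \<omega>) * indicator (E n) \<omega> \<partial>M)"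
      using n Suc.prems by (intro add_left_mono split EM) (auto simp: E_def)
    \<comment> \<open>Whether a path is still below the level is known at time \<open>n\<close>, so
      \<open>E n\<close> is an admissible test set for the one-step hypothesis.\<close>
    also have "\<dots> \<le> ennreal l * emeasure M (H n) + (\<integral>\<^sup>+\<omega>. ennreal (S n \<omega>) * indicator (E n) \<omega> \<partial>M)"
      using n by (intro add_left_mono step E) auto
    also have "\<dots> \<le> (\<integral>\<^sup>+\<omega>. ennreal (S 0 \<omega>) \<partial>M)"
      using Suc.IH n by simp
    finally show ?case .
  qed
  from order.trans[OF _ this[of N]] show ?thesis
    by (simp add: H_def)
qed

section \<open>Independence and Gaussian second moments\<close>

text \<open>Freezing lemma: by independence, the identity (read as a map into \<open>G\<close>) and
  \<open>Z\<close> have a product measure as joint law. Tonelli's theorem then allows the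
  \<open>G\<close>-measurable argument to be held fixed while \<open>Z\<close> is integrated
  out.\<close>

lemma (in prob_space) nn_integral_indep_set:
  assumes sub: "subalgebra M G" and Z: "Z \<in> borel_measurable M"
    and indep: "indep_set (sets G) (sets (vimage_algebra (space M) Z borel))"
    and \<Phi>[measurable]: "\<Phi> \<in> borel_measurable (G \<Otimes>\<^sub>M borel)"
  shows "(\<integral>\<^sup>+\<omega>. \<Phi> (\<omega>, Z \<omega>) \<partial>M) = (\<integral>\<^sup>+\<omega>. (\<integral>\<^sup>+z. \<Phi> (\<omega>, z) \<partial>distr M borel Z) \<partial>M)"
proof -
  have id: "(\<lambda>\<omega>. \<omega>) \<in> measurable M G"
    using sub by (intro measurableI) (auto simp: subalgebra_def Int_absorb2 sets.sets_into_space subset_iff)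
  have pair: "(\<lambda>\<omega>. (\<omega>, Z \<omega>)) \<in> measurable M (G \<Otimes>\<^sub>M borel)"
    by (rule measurable_Pair[OF id Z])
  interpret D: prob_space "distr M borel Z"
    by (rule prob_space_distr) (rule Z)
  interpret G: prob_space "distr M G (\<lambda>\<omega>. \<omega>)"
    by (rule prob_space_distr) (rule id)
  \<comment> \<open>Product measures are determined on rectangles, and there the claim is the
    product rule for \<open>A\<close> and the preimage of \<open>B\<close> under
    \<open>Z\<close>.\<close>
  have joint: "distr M G (\<lambda>\<omega>. \<omega>) \<Otimes>\<^sub>M distr M borel Z = distr M (G \<Otimes>\<^sub>M borel) (\<lambda>\<omega>. (\<omega>, Z \<omega>))"
  proof (rule pair_measure_eqI)
    fix A B assume "A \<in> sets (distr M G (\<lambda>\<omega>. \<omega>))" "B \<in> sets (distr M borel Z)"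
    then have A[measurable]: "A \<in> sets G" and B[measurable]: "B \<in> sets borel" by auto
    have Asub: "A \<subseteq> space M"
      using sets.sets_into_space[OF A] sub by (auto simp: subalgebra_def)
    have "Z -` B \<inter> space M \<in> sets (vimage_algebra (space M) Z borel)"
      using B by (auto simp: sets_vimage_algebra2)
    then have "prob (A \<inter> (Z -` B \<inter> space M)) = prob A * prob (Z -` B \<inter> space M)"
      using indep A by (intro indep_setD)
    moreover have "(\<lambda>\<omega>. (\<omega>, Z \<omega>)) -` (A \<times> B) \<inter> space M = A \<inter> (Z -` B \<inter> space M)"
      by auto
    ultimately show "emeasure (distr M G (\<lambda>\<omega>. \<omega>)) A * emeasure (distr M borel Z) B
        = emeasure (distr M (G \<Otimes>\<^sub>M borel) (\<lambda>\<omega>. (\<omega>, Z \<omega>))) (A \<times> B)"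
      using Asub A B by (simp add: emeasure_distr[OF id] emeasure_distr[OF Z] emeasure_distr[OF pair]
          emeasure_eq_measure ennreal_mult Int_absorb2)
  qed (auto intro: G.sigma_finite_measure_axioms D.sigma_finite_measure_axioms)
  have "(\<integral>\<^sup>+\<omega>. \<Phi> (\<omega>, Z \<omega>) \<partial>M) = (\<integral>\<^sup>+x. \<Phi> x \<partial>distr M (G \<Otimes>\<^sub>M borel) (\<lambda>\<omega>. (\<omega>, Z \<omega>)))"
    by (simp add: nn_integral_distr[OF pair])
  also have "\<dots> = (\<integral>\<^sup>+\<omega>. (\<integral>\<^sup>+z. \<Phi> (\<omega>, z) \<partial>distr M borel Z) \<partial>distr M G (\<lambda>\<omega>. \<omega>))"
    unfolding joint[symmetric] by (rule D.nn_integral_fst[symmetric]) measurable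
  also have "\<dots> = (\<integral>\<^sup>+\<omega>. (\<integral>\<^sup>+z. \<Phi> (\<omega>, z) \<partial>distr M borel Z) \<partial>M)"
    by (rule nn_integral_distr[OF id]) (rule D.borel_measurable_nn_integral, simp add: case_prod_unfold)
  finally show ?thesis .
qed

text \<open>Lebesgue measure on vectors is the image of a product of one-dimensional Lebesgue
  measures, under which integrals of product functions factor.\<close>

lemma has_bochner_integral_lborel_prod_vec:
  fixes F :: "'m::finite \<Rightarrow> real \<Rightarrow> real"
  assumes F: "\<And>i. has_bochner_integral lborel (F i) (c i)"
  shows "has_bochner_integral lborel (\<lambda>x :: real ^ 'm. \<Prod>i\<in>UNIV. F i (x $ i)) (\<Prod>i\<in>UNIV. c i)"
proof -
  let ?e = "\<lambda>i. axis i 1 :: real ^ 'm"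
  have inj: "inj ?e" by (auto simp: inj_def axis_eq_axis)
  have B: "(Basis :: (real ^ 'm) set) = range ?e" by (auto simp: Basis_vec_def)
  \<comment> \<open>The product measure is indexed by basis vectors, the family by coordinates;
    \<open>F'\<close> translates along \<open>axis i 1\<close>.\<close>
  define F' where "F' = (\<lambda>b. F (inv ?e b))"
  have F'e[simp]: "F' (?e i) = F i" for i by (simp add: F'_def inv_f_f[OF inj])
  interpret product_sigma_finite "\<lambda>_::real ^ 'm. lborel :: real measure" ..
  have int: "integrable lborel (F i)" "integral\<^sup>L lborel (F i) = c i" for i
    using F[of i] by (auto simp: has_bochner_integral_iff)
  have int': "integrable lborel (F' b)" if "b \<in> Basis" for b
    using that by (auto simp: B int)
  have rein: "(\<Prod>b\<in>Basis. F' b (y b)) = (\<Prod>i\<in>UNIV. F i (y (?e i)))" for y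
    unfolding B by (subst prod.reindex) (auto simp: inj)
  have comp: "(\<Sum>b\<in>Basis. y b * b $ i) = y (?e i)" for y :: "real ^ 'm \<Rightarrow> real" and i
    unfolding B sum.reindex[OF inj] by (simp add: axis_def if_distrib cong: if_cong)
  have [measurable]: "F i \<in> borel_measurable borel" for i
    using int(1)[of i] by simp
  have "has_bochner_integral (Pi\<^sub>M Basis (\<lambda>_. lborel)) (\<lambda>y. \<Prod>b\<in>Basis. F' b (y b)) (\<Prod>i\<in>UNIV. c i)"
    unfolding has_bochner_integral_iff
    by (intro conjI product_integrable_prod) (auto simp: int' product_integral_prod, simp add: B prod.reindex inj int)
  then show ?thesis
    by (subst lborel_eq, subst has_bochner_integral_distr) (auto simp: rein comp cong: measurable_cong_sets)
qed

lemma normal_density_monomials: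
  assumes "0 < \<sigma>"
  shows "has_bochner_integral lborel (normal_density 0 \<sigma>) 1"
    and "has_bochner_integral lborel (\<lambda>x. normal_density 0 \<sigma> x * x) 0"
    and "has_bochner_integral lborel (\<lambda>x. normal_density 0 \<sigma> x * x\<^sup>2) (\<sigma>\<^sup>2)"
  using normal_moment_nz_1[OF assms, of 0] normal_moment_even[OF assms, of 0 0] normal_moment_even[OF assms, of 0 1]
  by auto

text \<open>A monomial is a product over all coordinates, with factor 1 where a coordinate does not
  occur, so its integral factors into one-dimensional moments. First moments vanish, hence the mixed
  terms do too.\<close>

lemma normal_density_vec_moments:
  fixes k l :: "'m::finite" and \<sigma> :: real
  assumes "0 < \<sigma>"
  defines "\<phi> \<equiv> \<lambda>x :: real ^ 'm. \<Prod>i\<in>UNIV. normal_density 0 \<sigma> (x $ i)"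
  shows "has_bochner_integral lborel \<phi> 1"
    and "has_bochner_integral lborel (\<lambda>x. \<phi> x * x $ k) 0"
    and "has_bochner_integral lborel (\<lambda>x. \<phi> x * (x $ k * x $ l)) (if k = l then \<sigma>\<^sup>2 else 0)"
proof -
  note M = normal_density_monomials[OF \<open>0 < \<sigma>\<close>]
  show "has_bochner_integral lborel \<phi> 1"
    using has_bochner_integral_lborel_prod_vec[of "\<lambda>i. normal_density 0 \<sigma>" "\<lambda>i. 1"] M
    by (simp add: \<phi>_def)
  have sel: "(\<Prod>i\<in>UNIV. if i = k then y i else 1) = y k" for k :: 'm and y :: "'m \<Rightarrow> real"
    by (simp add: prod.If_cases)
  let ?F = "\<lambda>i x. normal_density 0 \<sigma> x * (if i = k then x else 1)"
  have "has_bochner_integral lborel (\<lambda>x :: real ^ 'm. \<Prod>i\<in>UNIV. ?F i (x $ i)) (\<Prod>i\<in>UNIV. if i = k then 0 else 1)"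
    by (intro has_bochner_integral_lborel_prod_vec) (use M in \<open>auto\<close>)
  then show "has_bochner_integral lborel (\<lambda>x. \<phi> x * x $ k) 0"
    by (simp add: \<phi>_def prod.distrib sel)
  let ?F = "\<lambda>i x. normal_density 0 \<sigma> x * ((if i = k then x else 1) * (if i = l then x else 1))"
  \<comment> \<open>The one-dimensional integrals: a second moment if \<open>i = k = l\<close>, a
    first moment if \<open>i\<close> is just one of \<open>k\<close> and \<open>l\<close>, and total
    mass 1 otherwise.\<close>
  let ?c = "\<lambda>i. if i = k then if k = l then \<sigma>\<^sup>2 else 0 else if i = l then 0 else 1"
  have "has_bochner_integral lborel (\<lambda>x :: real ^ 'm. \<Prod>i\<in>UNIV. ?F i (x $ i)) (\<Prod>i\<in>UNIV. ?c i)"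
    by (intro has_bochner_integral_lborel_prod_vec) (use M in \<open>auto simp: power2_eq_square\<close>)
  moreover have "(\<Prod>i\<in>UNIV. ?c i) = (if k = l then \<sigma>\<^sup>2 else 0)"
  proof (cases "k = l")
    case True
    then have "?c = (\<lambda>i. if i = k then \<sigma>\<^sup>2 else 1)" by auto
    then show ?thesis using True sel[of k "\<lambda>_. \<sigma>\<^sup>2"] by metis
  next
    case False
    then have "(\<Prod>i\<in>UNIV. ?c i) = 0" by (intro prod_zero) auto
    then show ?thesis using False by simp
  qed
  ultimately show "has_bochner_integral lborel (\<lambda>x. \<phi> x * (x $ k * x $ l)) (if k = l then \<sigma>\<^sup>2 else 0)"
    by (simp add: \<phi>_def prod.distrib sel)
qed

text \<open>Expand the square into monomials in \<open>z\<close>. The linear terms integrate to 0,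
  and of the quadratic ones only the diagonal survives, which sums to the squared Frobenius norm of
  \<open>A\<close>.\<close>

lemma nn_integral_normal_affine:
  fixes y :: "real ^ 'd" and A :: "real ^ 'm ^ 'd"
  assumes "0 < \<sigma>"
  shows "(\<integral>\<^sup>+z. ennreal ((norm (y + A *v z))\<^sup>2)
      \<partial>density lborel (\<lambda>x. ennreal (\<Prod>i\<in>UNIV. normal_density 0 \<sigma> (x $ i))))
    = ennreal ((norm y)\<^sup>2 + \<sigma>\<^sup>2 * (norm A)\<^sup>2)"
proof -
  define \<phi> where "\<phi> x = (\<Prod>i\<in>UNIV. normal_density 0 \<sigma> (x $ i))" for x :: "real ^ 'm"
  note M = normal_density_vec_moments[OF \<open>0 < \<sigma>\<close>, where 'm = 'm, folded \<phi>_def]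
  have \<phi>[measurable]: "\<phi> \<in> borel_measurable borel"
    unfolding \<phi>_def[abs_def] by measurable
  have \<phi>0: "0 \<le> \<phi> x" for x unfolding \<phi>_def by (intro prod_nonneg) auto
  have nsq: "(norm x)\<^sup>2 = (\<Sum>i\<in>UNIV. (x $ i)\<^sup>2)" for x :: "real ^ 'd"
    by (simp add: norm_vec_def L2_set_def sum_nonneg)
  have expand: "(norm (y + A *v z))\<^sup>2 = (\<Sum>i\<in>UNIV. (y $ i)\<^sup>2 + (\<Sum>k\<in>UNIV. 2 * y $ i * A $ i $ k * z $ k)
      + (\<Sum>k\<in>UNIV. \<Sum>l\<in>UNIV. A $ i $ k * A $ i $ l * (z $ k * z $ l)))" for z
    unfolding nsq
    by (simp add: power2_sum matrix_vector_mult_def sum_distrib_left power2_eq_square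
        sum_product algebra_simps flip: sum.distrib)
  have "has_bochner_integral lborel (\<lambda>z. \<Sum>i\<in>UNIV. (y $ i)\<^sup>2 * \<phi> z + (\<Sum>k\<in>UNIV. (2 * y $ i * A $ i $ k) * (\<phi> z * z $ k))
      + (\<Sum>k\<in>UNIV. \<Sum>l\<in>UNIV. (A $ i $ k * A $ i $ l) * (\<phi> z * (z $ k * z $ l))))
     (\<Sum>i\<in>UNIV. (y $ i)\<^sup>2 * 1 + (\<Sum>k\<in>UNIV. (2 * y $ i * A $ i $ k) * 0)
      + (\<Sum>k\<in>UNIV. \<Sum>l\<in>UNIV. (A $ i $ k * A $ i $ l) * (if k = l then \<sigma>\<^sup>2 else 0)))"
    by (intro has_bochner_integral_sum has_bochner_integral_add has_bochner_integral_mult_right M)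
  also have "(\<lambda>z. \<Sum>i\<in>UNIV. (y $ i)\<^sup>2 * \<phi> z + (\<Sum>k\<in>UNIV. (2 * y $ i * A $ i $ k) * (\<phi> z * z $ k))
      + (\<Sum>k\<in>UNIV. \<Sum>l\<in>UNIV. (A $ i $ k * A $ i $ l) * (\<phi> z * (z $ k * z $ l))))
      = (\<lambda>z. \<phi> z * (norm (y + A *v z))\<^sup>2)"
    unfolding expand by (intro ext) (simp add: sum_distrib_left distrib_left mult_ac)
  also have "(\<Sum>i\<in>UNIV. (y $ i)\<^sup>2 * 1 + (\<Sum>k\<in>UNIV. (2 * y $ i * A $ i $ k) * 0)
      + (\<Sum>k\<in>UNIV. \<Sum>l\<in>UNIV. (A $ i $ k * A $ i $ l) * (if k = l then \<sigma>\<^sup>2 else 0)))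
      = (norm y)\<^sup>2 + \<sigma>\<^sup>2 * (norm A)\<^sup>2"
    by (simp add: norm_vec_def L2_set_def sum_nonneg sum.distrib sum_distrib_left if_distrib power2_eq_square mult_ac cong: if_cong)
  finally have I: "has_bochner_integral lborel (\<lambda>z. \<phi> z * (norm (y + A *v z))\<^sup>2) ((norm y)\<^sup>2 + \<sigma>\<^sup>2 * (norm A)\<^sup>2)" .
  have [measurable]: "(\<lambda>z. y + A *v z) \<in> borel_measurable borel"
    by (intro borel_measurable_continuous_onI continuous_intros)
  have "(\<integral>\<^sup>+z. ennreal ((norm (y + A *v z))\<^sup>2) \<partial>density lborel (\<lambda>x. ennreal (\<phi> x)))
      = (\<integral>\<^sup>+z. ennreal (\<phi> z * (norm (y + A *v z))\<^sup>2) \<partial>lborel)"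
    by (subst nn_integral_density) (auto simp: ennreal_mult \<phi>0)
  also have "\<dots> = ennreal ((norm y)\<^sup>2 + \<sigma>\<^sup>2 * (norm A)\<^sup>2)"
    using I by (subst nn_integral_eq_integral) (auto simp: has_bochner_integral_iff \<phi>0)
  finally show ?thesis unfolding \<phi>_def .
qed

section \<open>Energy estimate for one implicit step\<close>

text \<open>Expand the square of \<open>x = y - h *\<^sub>R f y\<close> and drop the nonnegative
  term in \<open>f y\<close> alone. The growth condition at the new point \<open>y\<close> controls
  the inner product and puts \<open>h * (norm (g y))\<^sup>2\<close> on the left. In the application
  \<open>x\<close> is the old value plus the noise term.\<close>

lemma backward_euler_energy:
  fixes x y :: "real ^ 'd"
  assumes "f y \<bullet> y + 1 / 2 * (norm (g y))\<^sup>2 \<le> L * (1 + (norm y)\<^sup>2)" "0 \<le> h"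
    and eq: "y = x + h *\<^sub>R f y"
  shows "(1 - 2 * h * L) * (norm y)\<^sup>2 + h * (norm (g y))\<^sup>2 \<le> (norm x)\<^sup>2 + 2 * h * L"
proof -
  have "(norm x)\<^sup>2 = (norm (y - h *\<^sub>R f y))\<^sup>2" using eq by (metis add_diff_cancel)
  also have "\<dots> = (norm y)\<^sup>2 - 2 * h * (f y \<bullet> y) + h\<^sup>2 * (norm (f y))\<^sup>2"
    by (simp only: power2_norm_eq_inner) (simp add: inner_diff_left inner_diff_right inner_commute power2_eq_square)
  also have "\<dots> \<ge> (norm y)\<^sup>2 - 2 * h * (f y \<bullet> y)" by simp
  finally have "(norm y)\<^sup>2 - 2 * h * (f y \<bullet> y) \<le> (norm x)\<^sup>2" .
  moreover have "2 * h * (f y \<bullet> y + 1 / 2 * (norm (g y))\<^sup>2) \<le> 2 * h * (L * (1 + (norm y)\<^sup>2))"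
    using assms by (intro mult_left_mono) auto
  ultimately show ?thesis by (simp add: algebra_simps)
qed

section \<open>One step integrated over sets of the filtration\<close>

lemma borel_measurable_matrix_vector_mult [measurable (raw)]:
  fixes A :: "'a \<Rightarrow> real ^ 'm ^ 'd"
  assumes "A \<in> borel_measurable M" "z \<in> borel_measurable M"
  shows "(\<lambda>x. A x *v z x) \<in> borel_measurable M"
proof (rule borel_measurable_continuous_Pair[OF assms])
  show "continuous_on UNIV (\<lambda>x :: (real ^ 'm ^ 'd) \<times> (real ^ 'm). fst x *v snd x)"
    unfolding matrix_vector_mult_def by (intro continuous_intros)
qed

text \<open>Freeze \<open>y\<close>, \<open>B\<close> and the indicator of \<open>A\<close>, all
  \<open>G\<close>-measurable, and use the Gaussian formula for the inner integral. This is the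
  conditional second moment in the tested form that the maximal inequality asks for.\<close>

lemma (in prob_space) nn_integral_indep_normal_affine:
  fixes y :: "'a \<Rightarrow> real ^ 'd" and B :: "'a \<Rightarrow> real ^ 'm ^ 'd" and Z :: "'a \<Rightarrow> real ^ 'm"
  assumes sub: "subalgebra M G"
    and Z: "distributed M lborel Z (\<lambda>x. ennreal (\<Prod>i\<in>UNIV. normal_density 0 \<sigma> (x $ i)))"
    and indep: "indep_set (sets G) (sets (vimage_algebra (space M) Z borel))"
    and [measurable]: "y \<in> borel_measurable G" "B \<in> borel_measurable G" "A \<in> sets G"
    and \<sigma>: "0 < \<sigma>"
  shows "(\<integral>\<^sup>+\<omega>. ennreal ((norm (y \<omega> + B \<omega> *v Z \<omega>))\<^sup>2) * indicator A \<omega> \<partial>M)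
    = (\<integral>\<^sup>+\<omega>. ennreal ((norm (y \<omega>))\<^sup>2 + \<sigma>\<^sup>2 * (norm (B \<omega>))\<^sup>2) * indicator A \<omega> \<partial>M)"
proof -
  let ?\<Phi> = "\<lambda>(\<omega>, z). ennreal ((norm (y \<omega> + B \<omega> *v z))\<^sup>2) * indicator A \<omega>"
  have Zm: "Z \<in> borel_measurable M"
    using Z by (simp add: distributed_def)
  have D: "distr M borel Z = density lborel (\<lambda>x. ennreal (\<Prod>i\<in>UNIV. normal_density 0 \<sigma> (x $ i)))"
    using Z by (simp add: distributed_def cong: distr_cong)
  have "(\<integral>\<^sup>+\<omega>. ?\<Phi> (\<omega>, Z \<omega>) \<partial>M) = (\<integral>\<^sup>+\<omega>. (\<integral>\<^sup>+z. ?\<Phi> (\<omega>, z) \<partial>distr M borel Z) \<partial>M)"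
    by (rule nn_integral_indep_set[OF sub Zm indep]) measurable
  also have "\<dots> = (\<integral>\<^sup>+\<omega>. ennreal ((norm (y \<omega>))\<^sup>2 + \<sigma>\<^sup>2 * (norm (B \<omega>))\<^sup>2) * indicator A \<omega> \<partial>M)"
  proof (rule nn_integral_cong)
    fix \<omega>
    have "(\<integral>\<^sup>+z. ennreal ((norm (y \<omega> + B \<omega> *v z))\<^sup>2) * indicator A \<omega> \<partial>distr M borel Z)
        = (\<integral>\<^sup>+z. ennreal ((norm (y \<omega> + B \<omega> *v z))\<^sup>2) \<partial>distr M borel Z) * indicator A \<omega>"
      by (rule nn_integral_multc) measurable
    then show "(\<integral>\<^sup>+z. ?\<Phi> (\<omega>, z) \<partial>distr M borel Z)
      = ennreal ((norm (y \<omega>))\<^sup>2 + \<sigma>\<^sup>2 * (norm (B \<omega>))\<^sup>2) * indicator A \<omega>"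
      by (simp add: D nn_integral_normal_affine[OF \<sigma>])
  qed
  finally show ?thesis by simp
qed

text \<open>Both sides split into \<open>a\<close> times the given integral plus \<open>k\<close>
  times the measure of \<open>A\<close>; since every term is nonnegative, this also holds when the
  integrals are infinite. It carries the equality of second moments through the weight and the
  constant of the energy bound.\<close>

lemma nn_set_integral_affine_cong:
  fixes X X' :: "'a \<Rightarrow> real"
  assumes eq: "(\<integral>\<^sup>+\<omega>. ennreal (X \<omega>) * indicator A \<omega> \<partial>M) = (\<integral>\<^sup>+\<omega>. ennreal (X' \<omega>) * indicator A \<omega> \<partial>M)"
    and [measurable]: "X \<in> borel_measurable M" "X' \<in> borel_measurable M" "A \<in> sets M"
    and nonneg: "\<And>\<omega>. 0 \<le> X \<omega>" "\<And>\<omega>. 0 \<le> X' \<omega>" "0 \<le> a" "0 \<le> k"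
  shows "(\<integral>\<^sup>+\<omega>. ennreal (a * X \<omega> + k) * indicator A \<omega> \<partial>M) = (\<integral>\<^sup>+\<omega>. ennreal (a * X' \<omega> + k) * indicator A \<omega> \<partial>M)"
proof -
  have "(\<integral>\<^sup>+\<omega>. ennreal (a * X \<omega> + k) * indicator A \<omega> \<partial>M)
     = ennreal a * (\<integral>\<^sup>+\<omega>. ennreal (X \<omega>) * indicator A \<omega> \<partial>M) + ennreal k * emeasure M A"
    if [measurable]: "X \<in> borel_measurable M" and "\<And>\<omega>. 0 \<le> X \<omega>" for X :: "'a \<Rightarrow> real"
  proof -
    have "(\<integral>\<^sup>+\<omega>. ennreal (a * X \<omega> + k) * indicator A \<omega> \<partial>M)
      = (\<integral>\<^sup>+\<omega>. ennreal a * (ennreal (X \<omega>) * indicator A \<omega>) + ennreal k * indicator A \<omega> \<partial>M)"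
      using that nonneg by (intro nn_integral_cong) (auto simp: ennreal_plus ennreal_mult split: split_indicator)
    also have "\<dots> = ennreal a * (\<integral>\<^sup>+\<omega>. ennreal (X \<omega>) * indicator A \<omega> \<partial>M) + ennreal k * emeasure M A"
      by (subst nn_integral_add) (auto simp: nn_integral_cmult nn_integral_cmult_indicator)
    finally show ?thesis .
  qed
  from this[of X] this[of X'] show ?thesis
    using eq nonneg by simp
qed

lemma standard_wiener_process_incrementD:
  assumes "standard_wiener_process M T F W" and st: "0 \<le> s" "s < t" "t \<le> T"
  shows "distributed M lborel (\<lambda>\<omega>. W t \<omega> - W s \<omega>)
      (\<lambda>x. ennreal (\<Prod>i\<in>UNIV. normal_density 0 (sqrt (t - s)) (x $ i)))"
    and "prob_space.indep_set M (sets (F s))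
      (sets (vimage_algebra (space M) (\<lambda>\<omega>. W t \<omega> - W s \<omega>) borel))"
  using assms(1) st unfolding standard_wiener_process_def by simp_all

section \<open>The moment bound for the scheme\<close>

text \<open>The expectation is a nonnegative integral, so the bound includes its finiteness. The
  case \<open>L = 0\<close> is separate because \<open>inverse (2 * L)\<close> then takes the
  default value 0 instead of infinity.\<close>

theorem proposition5:
  fixes M :: "'a measure" and F :: "real \<Rightarrow> 'a measure"
    and W :: "real \<Rightarrow> 'a \<Rightarrow> real ^ 'm"
    and f :: "real ^ 'd \<Rightarrow> real ^ 'd" and g :: "real ^ 'd \<Rightarrow> real ^ 'm ^ 'd"
    and X0 :: "real ^ 'd" and T L h0 :: real
  assumes "T > 0"
    and "prob_space M"
    and "filtration_upto M T F"
    and "standard_wiener_process M T F W"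
    and "continuous_on UNIV f"
    and "continuous_on UNIV g"
    and "L \<ge> 0"
    and "\<And>x. f x \<bullet> x + 1 / 2 * (norm (g x))\<^sup>2 \<le> L * (1 + (norm x)\<^sup>2)"
    and "0 < h0"
    and "L = 0 \<or> h0 < inverse (2 * L)"
  shows "\<forall>p h :: real. \<forall>N :: nat. \<forall>Y :: nat \<Rightarrow> 'a \<Rightarrow> real ^ 'd.
    0 < p \<longrightarrow> p < 1 \<longrightarrow> 0 < h \<longrightarrow> h < 1 \<longrightarrow> h < h0 \<longrightarrow>
    1 \<le> N \<longrightarrow> real N * h \<le> T \<longrightarrow> T < (real N + 1) * h \<longrightarrow>
    (\<forall>n\<le>N. Y n \<in> borel_measurable (F (real n * h))) \<longrightarrow>
    backward_euler_maruyama M W f g X0 h N Y \<longrightarrow>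
    (\<integral>\<^sup>+\<omega>. ennreal (SUP j\<in>{0..N}. ((norm (Y j \<omega>))\<^sup>2 + h * (norm (g (Y j \<omega>)))\<^sup>2) powr p) \<partial>M)
      \<le> ennreal ((1 + 1 / (1 - p))
          * exp (p * inverse (1 - 2 * h0 * L) * 2 * L * T)
          * ((norm X0)\<^sup>2 + inverse (1 - 2 * h0 * L) * (h0 * (norm (g X0))\<^sup>2 + 2 * L * T)) powr p)"
proof (intro allI impI)
  fix p h :: real and N :: nat and Y :: "nat \<Rightarrow> 'a \<Rightarrow> real ^ 'd"
  assume p: "0 < p" "p < 1" and h: "0 < h" "h < h0" and N: "real N * h \<le> T"
    and Y: "\<forall>n\<le>N. Y n \<in> borel_measurable (F (real n * h))"
    and bem: "backward_euler_maruyama M W f g X0 h N Y"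
  interpret prob_space M by fact
  note L = \<open>L \<ge> 0\<close>
  \<comment> \<open>\<open>c\<close> is the factor of the squared norm in the energy estimate,
    \<open>q\<close> the resulting growth per step, \<open>q0\<close> its bound uniform in
    \<open>h\<close>, and \<open>r = q - 1\<close>. \<open>K\<close> will bound the initial integral
    of \<open>S\<close>.\<close>
  define c where "c = 1 - 2 * h * L"
  define q where "q = inverse c"
  define q0 where "q0 = inverse (1 - 2 * h0 * L)"
  define r where "r = 2 * h * L * q"
  define K where "K = (norm X0)\<^sup>2 + q0 * (h0 * (norm (g X0))\<^sup>2 + 2 * L * T)"
  have c0: "0 < 1 - 2 * h0 * L"
    using assms(10) L by (cases "L = 0") (auto simp: field_simps)
  have hL: "h * L \<le> h0 * L"
    using h L by (intro mult_right_mono) auto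
  then have c: "0 < c" "c \<le> 1"
    using c0 h L by (auto simp: c_def)
  have q: "1 \<le> q" "q \<le> q0" "q * c = 1" "0 < q"
    using c c0 hL by (auto simp: q_def q0_def c_def one_le_inverse_iff intro!: le_imp_inverse_le)
  have qr: "q = 1 + r"
    using q(3) by (simp add: r_def c_def algebra_simps)
  have r0: "0 \<le> r"
    using h L q by (simp add: r_def)
  have K0: "0 \<le> K"
    using q assms(1,7,9) by (simp add: K_def)

  \<comment> \<open>\<open>V\<close> is the quantity to be bounded and, by the Gaussian formula,
    also the conditional second moment of the next explicit part; \<open>U\<close> is the left-hand
    side of the energy estimate.\<close>
  define V where "V j \<omega> = (norm (Y j \<omega>))\<^sup>2 + h * (norm (g (Y j \<omega>)))\<^sup>2" for j \<omega>
  define U where "U j \<omega> = c * (norm (Y j \<omega>))\<^sup>2 + h * (norm (g (Y j \<omega>)))\<^sup>2" for j \<omega>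
  \<comment> \<open>The nonnegative supermartingale: the energy \<open>q * U\<close>, discounted by the growth factor \<open>q\<close> per
    step, plus the total of the deterministic increments that are still to come.\<close>
  define S where "S j \<omega> = q * U j \<omega> * c ^ j + real (N - j) * r" for j \<omega>
  have V0: "0 \<le> V j \<omega>" and U0: "0 \<le> U j \<omega>" and S0: "0 \<le> S j \<omega>" for j \<omega>
    using c h q r0 by (auto simp: V_def U_def S_def)
  \<comment> \<open>The factor \<open>q\<close> restores the full weight of the squared norm, as
    \<open>q * c = 1\<close>, and only increases the term in \<open>g\<close>. Undoing the discount
    costs \<open>q ^ j\<close>, at most \<open>q ^ N\<close>.\<close>
  have V_le_S: "V j \<omega> \<le> q ^ N * S j \<omega>" if "j \<le> N" for j \<omega>
  proof -
    have "V j \<omega> = (norm (Y j \<omega>))\<^sup>2 + 1 * (h * (norm (g (Y j \<omega>)))\<^sup>2)"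
      by (simp add: V_def)
    also have "\<dots> \<le> (norm (Y j \<omega>))\<^sup>2 + q * (h * (norm (g (Y j \<omega>)))\<^sup>2)"
      using h q by (intro add_left_mono mult_right_mono) auto
    also have "\<dots> = (q * c) * (norm (Y j \<omega>))\<^sup>2 + q * (h * (norm (g (Y j \<omega>)))\<^sup>2)"
      by (simp add: q(3))
    also have "\<dots> = q * U j \<omega>"
      by (simp add: U_def algebra_simps)
    also have "\<dots> = q ^ j * (q * U j \<omega> * c ^ j)"
    proof -
      have "q ^ j * c ^ j = 1"
        by (simp add: q(3) flip: power_mult_distrib)
      then show ?thesis
        by (simp add: mult.left_commute[of "q ^ j"])
    qed
    also have "\<dots> \<le> q ^ j * S j \<omega>"
      using q r0 by (intro mult_left_mono) (auto simp: S_def)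
    also have "\<dots> \<le> q ^ N * S j \<omega>"
      using q that by (intro mult_right_mono power_increasing S0) auto
    finally show ?thesis .
  qed

  define G where "G n = F (real n * h)" for n
  \<comment> \<open>The filtration and the Wiener process are specified on \<open>[0, T]\<close>
    only, so grid times must lie there.\<close>
  have time: "real n * h \<in> {0..T}" if "n \<le> N" for n
  proof -
    have "real n * h \<le> real N * h" using h that by (intro mult_right_mono) auto
    from order.trans[OF this N] show ?thesis using h by simp
  qed
  have sub: "subalgebra M (G n)" if "n \<le> N" for n
    using assms(3) time[OF that] by (auto simp: filtration_upto_def G_def)
  have filt: "subalgebra (G n) (G m)" if "m \<le> n" "n \<le> N" for m n
    using assms(3) time[OF that(2)] that h
    by (auto simp: filtration_upto_def G_def intro!: mult_right_mono)
  have YG: "Y n \<in> borel_measurable (G n)" if "n \<le> N" for n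
    using Y that by (simp add: G_def)
  have g: "g \<in> borel_measurable borel"
    using assms(6) by (rule borel_measurable_continuous_onI)
  have gYG: "(\<lambda>\<omega>. g (Y n \<omega>)) \<in> borel_measurable (G n)" if "n \<le> N" for n
    using measurable_comp[OF YG[OF that] g] by (simp add: comp_def)
  have SG: "S n \<in> borel_measurable (G n)" if "n \<le> N" for n
    using YG[OF that, measurable] gYG[OF that, measurable]
    unfolding S_def[abs_def] U_def[abs_def] by measurable
  have SM: "S n \<in> borel_measurable M" if "n \<le> N" for n
    using measurable_from_subalg[OF sub SG] that by blast

  \<comment> \<open>The supermartingale inequality for the discounted energy\<close>
  have step: "(\<integral>\<^sup>+\<omega>. ennreal (S (Suc n) \<omega>) * indicator A \<omega> \<partial>M)
      \<le> (\<integral>\<^sup>+\<omega>. ennreal (S n \<omega>) * indicator A \<omega> \<partial>M)"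
    if n: "n < N" and A: "A \<in> sets (G n)" for n A
  proof -
    define Z where "Z \<omega> = W (real (n + 1) * h) \<omega> - W (real n * h) \<omega>" for \<omega>
    define x where "x \<omega> = Y n \<omega> + g (Y n \<omega>) *v Z \<omega>" for \<omega>
    \<comment> \<open>The deterministic part of the bound: the discounted constant of the energy
      estimate and the increments remaining after time \<open>Suc n\<close>.\<close>
    define k where "k = c ^ n * (2 * h * L) + real (N - Suc n) * r"
    have k0: "0 \<le> k" using c h L r0 by (simp add: k_def)
    have t: "0 \<le> real n * h" "real n * h < real (n + 1) * h" "real (n + 1) * h \<le> T"
        "real (n + 1) * h - real n * h = h"
      using h time[of "n + 1"] n by (auto simp: algebra_simps)
    have Z: "distributed M lborel Z (\<lambda>x. ennreal (\<Prod>i\<in>UNIV. normal_density 0 (sqrt h) (x $ i)))"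
      using standard_wiener_process_incrementD(1)[OF assms(4) t(1-3)]
      unfolding t(4) Z_def[abs_def] .
    have indep: "indep_set (sets (G n)) (sets (vimage_algebra (space M) Z borel))"
      using standard_wiener_process_incrementD(2)[OF assms(4) t(1-3)]
      unfolding Z_def[abs_def] G_def .
    have [measurable]: "Z \<in> borel_measurable M"
      using Z by (simp add: distributed_def)
    have [measurable]: "Y n \<in> borel_measurable M" "(\<lambda>\<omega>. g (Y n \<omega>)) \<in> borel_measurable M" "A \<in> sets M"
      using measurable_from_subalg[OF sub YG] measurable_from_subalg[OF sub gYG] sub[of n] n A
      by (auto simp: subalgebra_def)
    have "AE \<omega> in M. Y (n + 1) \<omega> = Y n \<omega> + h *\<^sub>R f (Y (n + 1) \<omega>) + g (Y n \<omega>) *v Z \<omega>"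
      using bem n unfolding backward_euler_maruyama_def Z_def by blast
    then have "AE \<omega> in M. S (Suc n) \<omega> \<le> c ^ n * (norm (x \<omega>))\<^sup>2 + k"
    proof (rule AE_mp, intro AE_I2 impI)
      fix \<omega> assume "Y (n + 1) \<omega> = Y n \<omega> + h *\<^sub>R f (Y (n + 1) \<omega>) + g (Y n \<omega>) *v Z \<omega>"
      then have "U (Suc n) \<omega> \<le> (norm (x \<omega>))\<^sup>2 + 2 * h * L"
        unfolding U_def c_def using h
        by (intro backward_euler_energy[of f _ g] assms(8)) (auto simp: x_def add_ac)
      then have "c ^ n * U (Suc n) \<omega> \<le> c ^ n * ((norm (x \<omega>))\<^sup>2 + 2 * h * L)"
        using c by (intro mult_left_mono) auto
      \<comment> \<open>The factor \<open>q\<close> cancels one of the \<open>Suc n\<close> discount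
        factors, leaving the weight \<open>c ^ n\<close>.\<close>
      moreover have "S (Suc n) \<omega> = (q * c) * (c ^ n * U (Suc n) \<omega>) + real (N - Suc n) * r"
        by (simp add: S_def)
      ultimately show "S (Suc n) \<omega> \<le> c ^ n * (norm (x \<omega>))\<^sup>2 + k"
        unfolding q(3) k_def by (simp add: algebra_simps)
    qed
    then have "(\<integral>\<^sup>+\<omega>. ennreal (S (Suc n) \<omega>) * indicator A \<omega> \<partial>M)
        \<le> (\<integral>\<^sup>+\<omega>. ennreal (c ^ n * (norm (x \<omega>))\<^sup>2 + k) * indicator A \<omega> \<partial>M)"
      by (intro nn_integral_mono_AE) (auto intro!: mult_right_mono ennreal_leI elim!: eventually_mono)
    \<comment> \<open>Here the noise is averaged out: on sets of \<open>G n\<close>, the square of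
      \<open>x\<close> integrates to the same value as \<open>V n\<close>.\<close>
    also have "\<dots> = (\<integral>\<^sup>+\<omega>. ennreal (c ^ n * V n \<omega> + k) * indicator A \<omega> \<partial>M)"
    proof (rule nn_set_integral_affine_cong)
      show "(\<integral>\<^sup>+\<omega>. ennreal ((norm (x \<omega>))\<^sup>2) * indicator A \<omega> \<partial>M) = (\<integral>\<^sup>+\<omega>. ennreal (V n \<omega>) * indicator A \<omega> \<partial>M)"
        using nn_integral_indep_normal_affine[OF sub Z indep YG gYG A] n h
        by (simp add: x_def V_def)
    qed (use c k0 V0 in \<open>auto simp: x_def V_def[abs_def]\<close>)
    also have "\<dots> \<le> (\<integral>\<^sup>+\<omega>. ennreal (S n \<omega>) * indicator A \<omega> \<partial>M)"
    proof (intro nn_integral_mono mult_right_mono ennreal_leI)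
      fix \<omega>
      have "V n \<omega> \<le> q * U n \<omega>"
      proof -
        have "q * U n \<omega> = (q * c) * (norm (Y n \<omega>))\<^sup>2 + q * (h * (norm (g (Y n \<omega>)))\<^sup>2)"
          by (simp add: U_def algebra_simps)
        moreover have "1 * (h * (norm (g (Y n \<omega>)))\<^sup>2) \<le> q * (h * (norm (g (Y n \<omega>)))\<^sup>2)"
          using h q by (intro mult_right_mono) auto
        ultimately show ?thesis by (simp add: q(3) V_def)
      qed
      then have "c ^ n * V n \<omega> \<le> c ^ n * (q * U n \<omega>)"
        using c by (intro mult_left_mono) auto
      \<comment> \<open>The constant of this step is at most \<open>r\<close>, exactly the amount by
        which the stock of increments drops from \<open>N - n\<close> to
        \<open>N - Suc n\<close>.\<close>
      moreover have "c ^ n * (2 * h * L) \<le> q * (2 * h * L)"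
        using c q h L by (intro mult_right_mono order.trans[OF power_le_one q(1)]) auto
      moreover have "real (N - n) = 1 + real (N - Suc n)"
        using n by simp
      ultimately show "c ^ n * V n \<omega> + k \<le> S n \<omega>"
        by (simp add: S_def k_def r_def algebra_simps)
    qed simp
    finally show ?thesis .
  qed

  \<comment> \<open>The maximum of the supermartingale, its tail and its moment\<close>
  define X where "X \<omega> = Max ((\<lambda>j. S j \<omega>) ` {..N})" for \<omega>
  have XM: "X \<in> borel_measurable M"
    unfolding X_def[abs_def] using SM by (intro borel_measurable_Max) auto
  have X_ge: "S j \<omega> \<le> X \<omega>" if "j \<le> N" for j \<omega>
    unfolding X_def using that by (intro Max_ge) auto
  have X0: "0 \<le> X \<omega>" for \<omega>
    using X_ge[of 0 \<omega>] S0[of 0 \<omega>] by simp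
  have S_init: "(\<integral>\<^sup>+\<omega>. ennreal (S 0 \<omega>) \<partial>M) \<le> ennreal K"
  proof -
    have "AE \<omega> in M. S 0 \<omega> \<le> K"
    proof -
      have "AE \<omega> in M. Y 0 \<omega> = X0"
        using bem by (simp add: backward_euler_maruyama_def)
      then show ?thesis
      proof (rule AE_mp, intro AE_I2 impI)
        fix \<omega> assume "Y 0 \<omega> = X0"
        \<comment> \<open>The compensator \<open>N * r\<close> equals
          \<open>q * 2 * L * (N * h)\<close>, so \<open>N * h \<le> T\<close> and
          \<open>q \<le> q0\<close> make the bound independent of \<open>h\<close>.\<close>
        then have "S 0 \<omega> = (q * c) * (norm X0)\<^sup>2 + q * (h * (norm (g X0))\<^sup>2 + 2 * L * (real N * h))"
          by (simp add: S_def U_def r_def algebra_simps)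
        also have "\<dots> \<le> (norm X0)\<^sup>2 + q0 * (h0 * (norm (g X0))\<^sup>2 + 2 * L * T)"
          unfolding q(3) mult_1_left using q h L N
          by (intro add_mono mult_mono order.refl) auto
        finally show "S 0 \<omega> \<le> K" by (simp add: K_def)
      qed
    qed
    then have "(\<integral>\<^sup>+\<omega>. ennreal (S 0 \<omega>) \<partial>M) \<le> (\<integral>\<^sup>+\<omega>. ennreal K \<partial>M)"
      by (intro nn_integral_mono_AE) (auto intro: ennreal_leI elim: eventually_mono)
    then show ?thesis by (simp add: emeasure_space_1)
  qed
  have tail: "ennreal l * emeasure M {\<omega>\<in>space M. l \<le> X \<omega>} \<le> ennreal K" for l
  proof -
    have "{\<omega>\<in>space M. l \<le> X \<omega>} = {\<omega>\<in>space M. \<exists>j\<le>N. l \<le> S j \<omega>}"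
      unfolding X_def by (subst Max_ge_iff) auto
    moreover have "ennreal l * emeasure M {\<omega>\<in>space M. \<exists>j\<le>N. l \<le> S j \<omega>} \<le> (\<integral>\<^sup>+\<omega>. ennreal (S 0 \<omega>) \<partial>M)"
      by (rule nn_supermartingale_maximal_inequality[where G = G]) (fact sub filt SG step)+
    ultimately show ?thesis
      using S_init by simp
  qed
  have moment: "(\<integral>\<^sup>+\<omega>. ennreal (X \<omega> powr p) \<partial>M) \<le> ennreal (K powr p / (1 - p))"
    by (rule nn_integral_powr_le_of_tail) (rule XM X0 tail K0 p)+

  \<comment> \<open>Undoing the discount and collecting the constants\<close>
  have qN: "q ^ N \<le> exp (q0 * 2 * L * T)"
  proof -
    \<comment> \<open>Since \<open>q = 1 + r\<close>, the growth over all steps is at most the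
      exponential of \<open>N * r\<close>, where \<open>N * h\<close> is again bounded by
      \<open>T\<close>.\<close>
    have "q ^ N \<le> exp r ^ N"
      using q exp_ge_add_one_self[of r] by (intro power_mono) (auto simp: qr)
    also have "\<dots> = exp (q * (2 * L) * (real N * h))"
      by (simp add: exp_of_nat_mult[symmetric] r_def mult_ac)
    also have "\<dots> \<le> exp (q0 * (2 * L) * T)"
      using q L N h by (simp, intro mult_mono) auto
    finally show ?thesis by (simp add: mult_ac)
  qed
  let ?e = "exp (p * q0 * 2 * L * T)"
  have "(SUP j\<in>{0..N}. V j \<omega> powr p) \<le> ?e * X \<omega> powr p" for \<omega>
  proof (rule cSUP_least)
    fix j assume "j \<in> {0..N}"
    then have j: "j \<le> N" by simp
    have "V j \<omega> \<le> exp (q0 * 2 * L * T) * X \<omega>"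
      using V_le_S[OF j, of \<omega>] mult_mono[OF qN X_ge[OF j, of \<omega>]] S0[of j \<omega>] by simp
    then have "V j \<omega> powr p \<le> (exp (q0 * 2 * L * T) * X \<omega>) powr p"
      using V0 p by (intro powr_mono2) auto
    also have "\<dots> = ?e * X \<omega> powr p"
      using X0 by (simp add: powr_mult exp_powr_real mult_ac)
    finally show "V j \<omega> powr p \<le> ?e * X \<omega> powr p" .
  qed simp
  then have "(\<integral>\<^sup>+\<omega>. ennreal (SUP j\<in>{0..N}. V j \<omega> powr p) \<partial>M) \<le> (\<integral>\<^sup>+\<omega>. ennreal (?e * X \<omega> powr p) \<partial>M)"
    by (intro nn_integral_mono ennreal_leI)
  also have "\<dots> = ennreal ?e * (\<integral>\<^sup>+\<omega>. ennreal (X \<omega> powr p) \<partial>M)"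
    using XM by (simp add: ennreal_mult nn_integral_cmult)
  also have "\<dots> \<le> ennreal ?e * ennreal (K powr p / (1 - p))"
    by (intro mult_left_mono moment) simp
  also have "\<dots> = ennreal (?e * (K powr p / (1 - p)))"
    using p by (subst ennreal_mult) auto
  \<comment> \<open>Integrating the tail gives the factor \<open>1 / (1 - p)\<close>; the summand 1
    is added to reach the stated constant.\<close>
  also have "\<dots> \<le> ennreal ((1 + 1 / (1 - p)) * ?e * K powr p)"
  proof (rule ennreal_leI)
    have "(1 + 1 / (1 - p)) * ?e * K powr p = ?e * K powr p + ?e * (K powr p / (1 - p))"
      by (simp add: distrib_right)
    then show "?e * (K powr p / (1 - p)) \<le> (1 + 1 / (1 - p)) * ?e * K powr p"
      by simp
  qed
  finally show "(\<integral>\<^sup>+\<omega>. ennreal (SUP j\<in>{0..N}. ((norm (Y j \<omega>))\<^sup>2 + h * (norm (g (Y j \<omega>)))\<^sup>2) powr p) \<partial>M)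
      \<le> ennreal ((1 + 1 / (1 - p))
          * exp (p * inverse (1 - 2 * h0 * L) * 2 * L * T)
          * ((norm X0)\<^sup>2 + inverse (1 - 2 * h0 * L) * (h0 * (norm (g X0))\<^sup>2 + 2 * L * T)) powr p)"
    by (simp only: V_def K_def q0_def)
qed

end
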